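(* Let $\mathcal C$ be a finitely complete category with a factorization system $(\mathcal E,\mathcal M)$. The underlying functor $\overline{(-)}:\mathcal C\to\mathbf{Cat}$ preserves adjunctible maps: if $f:X\to Y$ in $\mathcal C$ is adjunctible (at every point of $Y$), then the functor $\overline f:\overline X\to\overline Y$ is adjunctible in $\mathbf{Cat}$, i.e. for every object $y$ of $\overline Y$ the comma category $\overline f/y$ has a terminal object (equivalently, $\overline f$ has a right adjoint).
   Context: A factorization system $(\mathcal E,\mathcal M)$ is an orthogonal one: both classes contain the isomorphisms and are closed under composition, every map factors as $m\circ e$ with $e\in\mathcal E$, $m\in\mathcal M$, and every $e\in\mathcal E$ is orthogonal (unique diagonal fill-ins) to every $m\in\mathcal M$. Maps in $\mathcal E$ are called final, maps in $\mathcal M$ discrete fibrations; a factorization of every map is chosen. A point of $X$ is a map $x:1\to X$; its chosen factorization is $x=(\downarrow x)\circ e_x$ with $e_x:1\to X/x$ final and $\downarrow x:X/x\to X$ in $\mathcal M$; $X/x$ is the slice of $X$ at $x$. An arrow $\alpha:x\to y$ of $X$ is a map $\alpha:1\to X/y$ with $(\downarrow y)\circ\alpha=x$; by orthogonality it corresponds to a unique map $\widehat\alpha:X/x\to X/y$ over $X$ with $\widehat\alpha\circ e_x=\alpha$. The underlying category $\overline X$ has the points of $X$ as objects, the arrows $x\to y$ as morphisms, identities $e_x$, and composition $\beta\circ\alpha:=\widehat\beta\circ\alpha$. For $f:X\to Y$ and a point $x$ of $X$, the arrow map $e_{f,x}:X/x\to Y/fx$ is the unique final map with $(\downarrow fx)\circ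 e_{f,x}=f\circ(\downarrow x)$ and $e_{f,x}\circ e_x=e_{fx}$. The functor $\overline f:\overline X\to\overline Y$ sends $x$ to $fx$ and $\alpha:x\to x'$ to $e_{f,x'}\circ\alpha:fx\to fx'$; this makes $\overline{(-)}$ a functor $\mathcal C\to\mathbf{Cat}$. A map $f:X\to Y$ is adjunctible at a point $y:1\to Y$ if the pullback $f/y$ of $\downarrow y:Y/y\to Y$ along $f$ has a final point, i.e. there is a map $1\to f/y$ in $\mathcal E$; $f$ is adjunctible if it is adjunctible at every point of $Y$. *)

theory Defs
  imports Main
begin

record ('o, 'm) cat =
  Obj :: "'o set"
  Arr :: "'m set"
  Dom :: "'m \<Rightarrow> 'o"
  Cod :: "'m \<Rightarrow> 'o"
  Ident :: "'o \<Rightarrow> 'm"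
  Comp :: "'m \<Rightarrow> 'm \<Rightarrow> 'm"  (infixl "\<cdot>\<index>" 70)

definition Hom :: "('o, 'm, 'z) cat_scheme \<Rightarrow> 'o \<Rightarrow> 'o \<Rightarrow> 'm set" where
  "Hom C A B = {f \<in> Arr C. Dom C f = A \<and> Cod C f = B}"

locale category =
  fixes C :: "('o, 'm, 'z) cat_scheme" (structure)
  assumes dom_obj: "f \<in> Arr C \<Longrightarrow> Dom C f \<in> Obj C"
    and cod_obj: "f \<in> Arr C \<Longrightarrow> Cod C f \<in> Obj C"
    and ident_hom: "A \<in> Obj C \<Longrightarrow> Ident C A \<in> Hom C A A"
    and comp_hom: "f \<in> Hom C A B \<Longrightarrow> g \<in> Hom C B D \<Longrightarrow> g \<cdot> f \<in> Hom C A D"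
    and ident_right: "f \<in> Hom C A B \<Longrightarrow> f \<cdot> Ident C A = f"
    and ident_left: "f \<in> Hom C A B \<Longrightarrow> Ident C B \<cdot> f = f"
    and comp_assoc: "f \<in> Hom C A B \<Longrightarrow> g \<in> Hom C B D \<Longrightarrow> h \<in> Hom C D D' \<Longrightarrow>
                       h \<cdot> (g \<cdot> f) = (h \<cdot> g) \<cdot> f"

definition is_iso :: "('o, 'm, 'z) cat_scheme \<Rightarrow> 'm \<Rightarrow> bool" where
  "is_iso C f \<longleftrightarrow> f \<in> Arr C \<and>
     (\<exists>g \<in> Hom C (Cod C f) (Dom C f).
        g \<cdot>\<^bsub>C\<^esub> f = Ident C (Dom C f) \<and> f \<cdot>\<^bsub>C\<^esub> g = Ident C (Cod C f))"

definition is_terminal :: "('o, 'm, 'z) cat_scheme \<Rightarrow> 'o \<Rightarrow> bool" where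
  "is_terminal C T \<longleftrightarrow> T \<in> Obj C \<and> (\<forall>A \<in> Obj C. \<exists>!f. f \<in> Hom C A T)"

definition is_pullback :: "('o, 'm, 'z) cat_scheme \<Rightarrow> 'm \<Rightarrow> 'm \<Rightarrow> 'o \<Rightarrow> 'm \<Rightarrow> 'm \<Rightarrow> bool" where
  "is_pullback C f g P p q \<longleftrightarrow>
     f \<in> Arr C \<and> g \<in> Arr C \<and> Cod C f = Cod C g \<and>
     p \<in> Hom C P (Dom C f) \<and> q \<in> Hom C P (Dom C g) \<and> f \<cdot>\<^bsub>C\<^esub> p = g \<cdot>\<^bsub>C\<^esub> q \<and>
     (\<forall>Q. \<forall>u \<in> Hom C Q (Dom C f). \<forall>v \<in> Hom C Q (Dom C g). f \<cdot>\<^bsub>C\<^esub> u = g \<cdot>\<^bsub>C\<^esub> v \<longrightarrow>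
        (\<exists>!h. h \<in> Hom C Q P \<and> p \<cdot>\<^bsub>C\<^esub> h = u \<and> q \<cdot>\<^bsub>C\<^esub> h = v))"

record ('o1, 'm1, 'o2, 'm2) functor_data =
  obj_map :: "'o1 \<Rightarrow> 'o2"
  arr_map :: "'m1 \<Rightarrow> 'm2"

definition is_functor ::
  "('o1, 'm1, 'y) cat_scheme \<Rightarrow> ('o2, 'm2, 'z) cat_scheme \<Rightarrow> ('o1, 'm1, 'o2, 'm2) functor_data \<Rightarrow> bool" where
  "is_functor A B F \<longleftrightarrow> category A \<and> category B \<and>
     (\<forall>a \<in> Obj A. obj_map F a \<in> Obj B) \<and>
     (\<forall>a a'. \<forall>h \<in> Hom A a a'. arr_map F h \<in> Hom B (obj_map F a) (obj_map F a')) \<and>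
     (\<forall>a \<in> Obj A. arr_map F (Ident A a) = Ident B (obj_map F a)) \<and>
     (\<forall>a a' a''. \<forall>h \<in> Hom A a a'. \<forall>k \<in> Hom A a' a''.
        arr_map F (k \<cdot>\<^bsub>A\<^esub> h) = arr_map F k \<cdot>\<^bsub>B\<^esub> arr_map F h)"

definition is_cone ::
  "('i, 'j, 'y) cat_scheme \<Rightarrow> ('o, 'm, 'z) cat_scheme \<Rightarrow> ('i, 'j, 'o, 'm) functor_data \<Rightarrow>
   'o \<Rightarrow> ('i \<Rightarrow> 'm) \<Rightarrow> bool" where
  "is_cone J C D L p \<longleftrightarrow> L \<in> Obj C \<and>
     (\<forall>j \<in> Obj J. p j \<in> Hom C L (obj_map D j)) \<and>
     (\<forall>u \<in> Arr J. arr_map D u \<cdot>\<^bsub>C\<^esub> p (Dom J u) = p (Cod J u))"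

definition is_limit ::
  "('i, 'j, 'y) cat_scheme \<Rightarrow> ('o, 'm, 'z) cat_scheme \<Rightarrow> ('i, 'j, 'o, 'm) functor_data \<Rightarrow>
   'o \<Rightarrow> ('i \<Rightarrow> 'm) \<Rightarrow> bool" where
  "is_limit J C D L p \<longleftrightarrow> is_cone J C D L p \<and>
     (\<forall>L' p'. is_cone J C D L' p' \<longrightarrow>
        (\<exists>!h. h \<in> Hom C L' L \<and> (\<forall>j \<in> Obj J. p j \<cdot>\<^bsub>C\<^esub> h = p' j)))"

text \<open>Every finite category is isomorphic to one whose objects and arrows are natural
  numbers, so shapes of this type cover all finite diagrams.\<close>

definition finitely_complete :: "('o, 'm, 'z) cat_scheme \<Rightarrow> bool" where
  "finitely_complete C \<longleftrightarrow>
     (\<forall>(J :: (nat, nat) cat) D. finite (Obj J) \<and> finite (Arr J) \<and> is_functor J C D \<longrightarrow>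
        (\<exists>L p. is_limit J C D L p))"

text \<open>The comma category \<open>F/b\<close>: an object is a pair \<open>(a, \<phi> : F a \<rightarrow> b)\<close>; a morphism carries its
  source and target, since the underlying arrow of the domain category does not determine them.\<close>

definition comma ::
  "('o1, 'm1, 'y) cat_scheme \<Rightarrow> ('o2, 'm2, 'z) cat_scheme \<Rightarrow> ('o1, 'm1, 'o2, 'm2) functor_data \<Rightarrow> 'o2 \<Rightarrow>
   ('o1 \<times> 'm2, ('o1 \<times> 'm2) \<times> 'm1 \<times> ('o1 \<times> 'm2)) cat" where
  "comma A B F b = \<lparr>
     Obj = {(a, \<phi>). a \<in> Obj A \<and> \<phi> \<in> Hom B (obj_map F a) b},
     Arr = {((a, \<phi>), h, (a', \<phi>')).
              a \<in> Obj A \<and> \<phi> \<in> Hom B (obj_map F a) b \<and>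
              a' \<in> Obj A \<and> \<phi>' \<in> Hom B (obj_map F a') b \<and>
              h \<in> Hom A a a' \<and> \<phi>' \<cdot>\<^bsub>B\<^esub> arr_map F h = \<phi>},
     Dom = (\<lambda>(s, h, t). s),
     Cod = (\<lambda>(s, h, t). t),
     Ident = (\<lambda>(a, \<phi>). ((a, \<phi>), Ident A a, (a, \<phi>))),
     Comp = (\<lambda>(s', k, t') (s, h, t). (s, k \<cdot>\<^bsub>A\<^esub> h, t')) \<rparr>"

definition adjunctible_functor ::
  "('o1, 'm1, 'y) cat_scheme \<Rightarrow> ('o2, 'm2, 'z) cat_scheme \<Rightarrow> ('o1, 'm1, 'o2, 'm2) functor_data \<Rightarrow> bool" where
  "adjunctible_functor A B F \<longleftrightarrow>
     is_functor A B F \<and> (\<forall>b \<in> Obj B. \<exists>t. is_terminal (comma A B F b) t)"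

text \<open>The chosen factorization of \<open>f\<close> is \<open>fib_part f \<cdot> fin_part f\<close>; the terminal object \<open>One\<close> is
  also chosen.\<close>

record ('o, 'm) fact_cat = "('o, 'm) cat" +
  One :: 'o
  Final :: "'m set"
  DiscFib :: "'m set"
  fin_part :: "'m \<Rightarrow> 'm"
  fib_part :: "'m \<Rightarrow> 'm"

definition orthogonal :: "('o, 'm, 'z) cat_scheme \<Rightarrow> 'm \<Rightarrow> 'm \<Rightarrow> bool" where
  "orthogonal C e m \<longleftrightarrow>
     (\<forall>u \<in> Hom C (Dom C e) (Dom C m). \<forall>v \<in> Hom C (Cod C e) (Cod C m).
        m \<cdot>\<^bsub>C\<^esub> u = v \<cdot>\<^bsub>C\<^esub> e \<longrightarrow>
        (\<exists>!d. d \<in> Hom C (Cod C e) (Dom C m) \<and> d \<cdot>\<^bsub>C\<^esub> e = u \<and> m \<cdot>\<^bsub>C\<^esub> d = v))"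

locale factorization_system = category C
  for C :: "('o, 'm, 'z) fact_cat_scheme" (structure) +
  assumes one_terminal: "is_terminal C (One C)"
    and final_arr: "Final C \<subseteq> Arr C"
    and fib_arr: "DiscFib C \<subseteq> Arr C"
    and iso_final: "is_iso C f \<Longrightarrow> f \<in> Final C"
    and iso_fib: "is_iso C f \<Longrightarrow> f \<in> DiscFib C"
    and final_comp: "f \<in> Final C \<Longrightarrow> g \<in> Final C \<Longrightarrow> Cod C f = Dom C g \<Longrightarrow> g \<cdot> f \<in> Final C"
    and fib_comp: "f \<in> DiscFib C \<Longrightarrow> g \<in> DiscFib C \<Longrightarrow> Cod C f = Dom C g \<Longrightarrow> g \<cdot> f \<in> DiscFib C"
    and fin_part: "f \<in> Arr C \<Longrightarrow> fin_part C f \<in> Final C"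
    and fib_part: "f \<in> Arr C \<Longrightarrow> fib_part C f \<in> DiscFib C"
    and dom_fin_part: "f \<in> Arr C \<Longrightarrow> Dom C (fin_part C f) = Dom C f"
    and cod_fin_part: "f \<in> Arr C \<Longrightarrow> Cod C (fin_part C f) = Dom C (fib_part C f)"
    and cod_fib_part: "f \<in> Arr C \<Longrightarrow> Cod C (fib_part C f) = Cod C f"
    and factorization: "f \<in> Arr C \<Longrightarrow> fib_part C f \<cdot> fin_part C f = f"
    and orthogonality: "e \<in> Final C \<Longrightarrow> m \<in> DiscFib C \<Longrightarrow> orthogonal C e m"

definition points :: "('o, 'm, 'z) fact_cat_scheme \<Rightarrow> 'o \<Rightarrow> 'm set" where
  "points C X = Hom C (One C) X"

text \<open>For a point \<open>x\<close> of \<open>X\<close>, \<open>slice C x\<close> is \<open>X/x\<close>; the map \<open>\<down>x\<close> is \<open>fib_part C x\<close> and \<open>e\<^sub>x\<close> is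
  \<open>fin_part C x\<close>.\<close>

definition slice :: "('o, 'm, 'z) fact_cat_scheme \<Rightarrow> 'm \<Rightarrow> 'o" where
  "slice C x = Dom C (fib_part C x)"

definition slice_arrows :: "('o, 'm, 'z) fact_cat_scheme \<Rightarrow> 'm \<Rightarrow> 'm \<Rightarrow> 'm set" where
  "slice_arrows C x y = {\<alpha> \<in> points C (slice C y). fib_part C y \<cdot>\<^bsub>C\<^esub> \<alpha> = x}"

definition hat :: "('o, 'm, 'z) fact_cat_scheme \<Rightarrow> 'm \<Rightarrow> 'm \<Rightarrow> 'm \<Rightarrow> 'm" where
  "hat C x y \<alpha> = (THE k. k \<in> Hom C (slice C x) (slice C y) \<and>
     fib_part C y \<cdot>\<^bsub>C\<^esub> k = fib_part C x \<and> k \<cdot>\<^bsub>C\<^esub> fin_part C x = \<alpha>)"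

text \<open>An arrow \<open>\<alpha> : x \<rightarrow> y\<close> is recorded as \<open>(x, \<alpha>, y)\<close>: distinct points may have the same chosen
  slice, so the map \<open>\<alpha>\<close> alone does not determine its codomain \<open>y\<close>.\<close>

definition underlying :: "('o, 'm, 'z) fact_cat_scheme \<Rightarrow> 'o \<Rightarrow> ('m, 'm \<times> 'm \<times> 'm) cat" where
  "underlying C X = \<lparr>
     Obj = points C X,
     Arr = {(x, \<alpha>, y). x \<in> points C X \<and> y \<in> points C X \<and> \<alpha> \<in> slice_arrows C x y},
     Dom = (\<lambda>(x, \<alpha>, y). x),
     Cod = (\<lambda>(x, \<alpha>, y). y),
     Ident = (\<lambda>x. (x, fin_part C x, x)),
     Comp = (\<lambda>(y, \<beta>, z) (x, \<alpha>, y'). (x, hat C y z \<beta> \<cdot>\<^bsub>C\<^esub> \<alpha>, z)) \<rparr>"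

definition arrow_map :: "('o, 'm, 'z) fact_cat_scheme \<Rightarrow> 'm \<Rightarrow> 'm \<Rightarrow> 'm" where
  "arrow_map C f x = (THE k. k \<in> Final C \<and> k \<in> Hom C (slice C x) (slice C (f \<cdot>\<^bsub>C\<^esub> x)) \<and>
     fib_part C (f \<cdot>\<^bsub>C\<^esub> x) \<cdot>\<^bsub>C\<^esub> k = f \<cdot>\<^bsub>C\<^esub> fib_part C x \<and>
     k \<cdot>\<^bsub>C\<^esub> fin_part C x = fin_part C (f \<cdot>\<^bsub>C\<^esub> x))"

definition underlying_map ::
  "('o, 'm, 'z) fact_cat_scheme \<Rightarrow> 'm \<Rightarrow> ('m, 'm \<times> 'm \<times> 'm, 'm, 'm \<times> 'm \<times> 'm) functor_data" where
  "underlying_map C f = \<lparr>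
     obj_map = (\<lambda>x. f \<cdot>\<^bsub>C\<^esub> x),
     arr_map = (\<lambda>(x, \<alpha>, x'). (f \<cdot>\<^bsub>C\<^esub> x, arrow_map C f x' \<cdot>\<^bsub>C\<^esub> \<alpha>, f \<cdot>\<^bsub>C\<^esub> x')) \<rparr>"

text \<open>Final maps contain the isomorphisms and are closed under composition, so whether the
  pullback \<open>f/y\<close> has a final point does not depend on which pullback is taken.\<close>

definition adjunctible_at :: "('o, 'm, 'z) fact_cat_scheme \<Rightarrow> 'm \<Rightarrow> 'm \<Rightarrow> bool" where
  "adjunctible_at C f y \<longleftrightarrow>
     (\<exists>P p q. is_pullback C f (fib_part C y) P p q \<and> (\<exists>t \<in> points C P. t \<in> Final C))"

definition adjunctible :: "('o, 'm, 'z) fact_cat_scheme \<Rightarrow> 'm \<Rightarrow> bool" where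
  "adjunctible C f \<longleftrightarrow> (\<forall>y \<in> points C (Cod C f). adjunctible_at C f y)"

end

(* For a point y of Y, the objects of the comma category of the underlying functor over y are the
   points of the pullback P = f/y, with projections p to X and q to Y/y. If t is a final point of
   P and x0 = p t, then t and e_x0 are two final points of objects over X; since p inherits
   orthogonality from the map it is pulled back from, P is isomorphic to X/x0 over X, and under
   this isomorphism q becomes X/x0 -> Y/f x0 -> Y/y. Hence every point of P corresponds to exactly
   one arrow into x0 that is compatible with q, so that t is terminal in the comma category. *)

theory Submission imports Defs begin

section \<open>Orthogonality and pullbacks in a category\<close>

lemma HomD:
  assumes "f \<in> Hom C A B"
  shows "f \<in> Arr C" "Dom C f = A" "Cod C f = B"
  using assms by (simp_all add: Hom_def)

lemma orthogonal_fill_in: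
  assumes "orthogonal C e m" "e \<in> Hom C A B" "m \<in> Hom C D E"
    and "u \<in> Hom C A D" "v \<in> Hom C B E" "m \<cdot>\<^bsub>C\<^esub> u = v \<cdot>\<^bsub>C\<^esub> e"
  shows "\<exists>!d. d \<in> Hom C B D \<and> d \<cdot>\<^bsub>C\<^esub> e = u \<and> m \<cdot>\<^bsub>C\<^esub> d = v"
  using assms by (auto simp: orthogonal_def Hom_def)

context category
begin

text \<open>Associativity makes both maps fill-ins of one square, with top
  \<open>d \<cdot> e\<close> and bottom \<open>m \<cdot> d\<close>. Two parallel maps can thus be
  compared by composing with \<open>e\<close> on one side and with \<open>m\<close> on the other,
  without naming a lifting problem.\<close>

lemma orthogonal_fill_in_unique:
  assumes "orthogonal C e m" "e \<in> Hom C A B" "m \<in> Hom C D E"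
    and d: "d \<in> Hom C B D" and d': "d' \<in> Hom C B D"
    and eq: "d \<cdot> e = d' \<cdot> e" "m \<cdot> d = m \<cdot> d'"
  shows "d = d'"
proof -
  have "m \<cdot> (d \<cdot> e) = (m \<cdot> d) \<cdot> e"
    by (rule comp_assoc[OF assms(2) d assms(3)])
  then have "\<exists>!k. k \<in> Hom C B D \<and> k \<cdot> e = d \<cdot> e \<and> m \<cdot> k = m \<cdot> d"
    using orthogonal_fill_in[OF assms(1-3) comp_hom[OF assms(2) d] comp_hom[OF d assms(3)]]
    by simp
  then show ?thesis
    using d d' eq by metis
qed

lemma pullback_hom:
  assumes "is_pullback C f g P p q" "f \<in> Hom C X Y"
  shows "g \<in> Hom C (Dom C g) Y" "p \<in> Hom C P X" "q \<in> Hom C P (Dom C g)" "f \<cdot> p = g \<cdot> q"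
  using assms by (auto simp: is_pullback_def Hom_def)

lemma pullback_lift:
  assumes "is_pullback C f g P p q" "f \<in> Hom C X Y"
    and "u \<in> Hom C Q X" "v \<in> Hom C Q (Dom C g)" "f \<cdot> u = g \<cdot> v"
  obtains h where "h \<in> Hom C Q P" "p \<cdot> h = u" "q \<cdot> h = v"
proof -
  have "u \<in> Hom C Q (Dom C f)" using assms(3) HomD(2)[OF assms(2)] by simp
  then have "\<exists>!h. h \<in> Hom C Q P \<and> p \<cdot> h = u \<and> q \<cdot> h = v"
    using assms(1,4,5) unfolding is_pullback_def by blast
  then show thesis using that by blast
qed

lemma pullback_unique:
  assumes pb: "is_pullback C f g P p q" and f: "f \<in> Hom C X Y"
    and h: "h \<in> Hom C Q P" and h': "h' \<in> Hom C Q P"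
    and eq: "p \<cdot> h = p \<cdot> h'" "q \<cdot> h = q \<cdot> h'"
  shows "h = h'"
proof -
  note pbh = pullback_hom[OF pb f]
  have "p \<cdot> h \<in> Hom C Q (Dom C f)" "q \<cdot> h \<in> Hom C Q (Dom C g)"
    using comp_hom[OF h pbh(2)] comp_hom[OF h pbh(3)] HomD(2)[OF f] by simp_all
  moreover have "f \<cdot> (p \<cdot> h) = g \<cdot> (q \<cdot> h)"
    using comp_assoc[OF h pbh(2) f] comp_assoc[OF h pbh(3,1)] pbh(4) by simp
  ultimately have "\<exists>!k. k \<in> Hom C Q P \<and> p \<cdot> k = p \<cdot> h \<and> q \<cdot> k = q \<cdot> h"
    using pb unfolding is_pullback_def by blast
  then show ?thesis
    using h h' eq by metis
qed

text \<open>A square against \<open>p\<close> extends along \<open>f\<close> and \<open>q\<close> to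
  a square against \<open>g\<close>. The fill-in there and the bottom map \<open>v\<close> are the
  two components of the fill-in into \<open>P\<close>. This stands in for stability of
  \<open>DiscFib\<close> under pullback, which is not among the axioms.\<close>

lemma orthogonal_pullback:
  assumes orth: "orthogonal C e g" and e: "e \<in> Arr C"
    and pb: "is_pullback C f g P p q" and f: "f \<in> Hom C X Y"
  shows "orthogonal C e p"
proof -
  note pbh = pullback_hom[OF pb f]
  let ?A = "Dom C e" and ?B = "Cod C e"
  have e': "e \<in> Hom C ?A ?B" using e by (simp add: Hom_def)
  have "\<exists>!d. d \<in> Hom C ?B P \<and> d \<cdot> e = u \<and> p \<cdot> d = v"
    if u: "u \<in> Hom C ?A P" and v: "v \<in> Hom C ?B X" and sq: "p \<cdot> u = v \<cdot> e" for u v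
  proof -
    have qu: "q \<cdot> u \<in> Hom C ?A (Dom C g)" by (rule comp_hom[OF u pbh(3)])
    have fv: "f \<cdot> v \<in> Hom C ?B Y" by (rule comp_hom[OF v f])
    have "g \<cdot> (q \<cdot> u) = (f \<cdot> v) \<cdot> e"
      using comp_assoc[OF u pbh(3,1)] comp_assoc[OF u pbh(2) f] comp_assoc[OF e' v f] pbh(4) sq
      by simp
    from orthogonal_fill_in[OF orth e' pbh(1) qu fv this]
    obtain k where k: "k \<in> Hom C ?B (Dom C g)" "k \<cdot> e = q \<cdot> u" "g \<cdot> k = f \<cdot> v"
      by blast
    obtain d where d: "d \<in> Hom C ?B P" "p \<cdot> d = v" "q \<cdot> d = k"
      using pullback_lift[OF pb f v k(1)] k(3) by metis
    have "d \<cdot> e = u"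
    proof (rule pullback_unique[OF pb f comp_hom[OF e' d(1)] u])
      show "p \<cdot> (d \<cdot> e) = p \<cdot> u"
        using comp_assoc[OF e' d(1) pbh(2)] d(2) sq by simp
      show "q \<cdot> (d \<cdot> e) = q \<cdot> u"
        using comp_assoc[OF e' d(1) pbh(3)] d(3) k(2) by simp
    qed
    moreover have "d' = d" if d': "d' \<in> Hom C ?B P" "d' \<cdot> e = u" "p \<cdot> d' = v" for d'
    proof (rule pullback_unique[OF pb f d'(1) d(1)])
      show "p \<cdot> d' = p \<cdot> d" using d' d by simp
      \<comment> \<open>The component along \<open>p\<close> is prescribed to be \<open>v\<close>;
        the component along \<open>q\<close> is a fill-in against \<open>g\<close>, hence determined
        as well.\<close>
      show "q \<cdot> d' = q \<cdot> d"
      proof (rule orthogonal_fill_in_unique[OF orth e' pbh(1)])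
        show "q \<cdot> d' \<in> Hom C ?B (Dom C g)" "q \<cdot> d \<in> Hom C ?B (Dom C g)"
          using comp_hom d'(1) d(1) pbh(3) by blast+
        show "(q \<cdot> d') \<cdot> e = (q \<cdot> d) \<cdot> e"
          using comp_assoc[OF e' d'(1) pbh(3)] d'(2) d(3) k(2) by simp
        show "g \<cdot> (q \<cdot> d') = g \<cdot> (q \<cdot> d)"
          using comp_assoc[OF d'(1) pbh(3,1)] comp_assoc[OF d'(1) pbh(2) f] pbh(4) d'(3) d(3) k(3)
          by simp
      qed
    qed
    ultimately show ?thesis using d by blast
  qed
  then show ?thesis
    unfolding orthogonal_def using HomD[OF pbh(2)] by simp
qed

end

section \<open>Cancellation of final maps and the factorization of points\<close>

context factorization_system
begin

text \<open>Factor \<open>g\<close> as \<open>m \<cdot> n\<close> with \<open>n\<close> final and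
  \<open>m\<close> a discrete fibration. Since \<open>g \<cdot> e\<close> and
  \<open>n \<cdot> e\<close> are both final, orthogonality to \<open>m\<close> forces
  \<open>m\<close> to be an isomorphism, so \<open>g\<close> is a composite of final maps.\<close>

lemma final_cancel_right:
  assumes e: "e \<in> Final C" "e \<in> Hom C A B" and g: "g \<in> Hom C B D"
    and ge: "g \<cdot> e \<in> Final C"
  shows "g \<in> Final C"
proof -
  define m n E where "m = fib_part C g" and "n = fin_part C g" and "E = Dom C m"
  note ga = HomD[OF g]
  have mF: "m \<in> DiscFib C" and nF: "n \<in> Final C"
    using fib_part fin_part ga by (auto simp: m_def n_def)
  have n: "n \<in> Hom C B E"
    using nF final_arr dom_fin_part cod_fin_part ga by (auto simp: m_def n_def E_def Hom_def)
  have m: "m \<in> Hom C E D"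
    using mF fib_arr cod_fib_part ga by (auto simp: m_def E_def Hom_def)
  have mn: "m \<cdot> n = g" using factorization ga by (simp add: m_def n_def)
  have E: "E \<in> Obj C" and D: "D \<in> Obj C" using m dom_obj cod_obj by (auto simp: Hom_def)
  have ne: "n \<cdot> e \<in> Hom C A E" and geh: "g \<cdot> e \<in> Hom C A D"
    using comp_hom e n g by blast+
  have neF: "n \<cdot> e \<in> Final C"
    using final_comp[OF e(1) nF] HomD[OF e(2)] HomD[OF n] by simp
  \<comment> \<open>With the identity as bottom map, the fill-in of this square is a section
    \<open>d\<close> of \<open>m\<close>.\<close>
  have "m \<cdot> (n \<cdot> e) = Ident C D \<cdot> (g \<cdot> e)"
    using comp_assoc[OF e(2) n m] mn ident_left[OF geh] by simp
  from orthogonal_fill_in[OF orthogonality[OF ge mF] geh m ne ident_hom[OF D] this]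
  obtain d where d: "d \<in> Hom C D E" "d \<cdot> (g \<cdot> e) = n \<cdot> e" "m \<cdot> d = Ident C D"
    by blast
  have dm: "d \<cdot> m \<in> Hom C E E" by (rule comp_hom[OF m d(1)])
  \<comment> \<open>The section is also a left inverse: both endomaps of \<open>E\<close> restrict
    to \<open>n \<cdot> e\<close> along the final map \<open>n \<cdot> e\<close> and become
    \<open>m\<close> after composing with \<open>m\<close>.\<close>
  have "d \<cdot> m = Ident C E"
  proof (rule orthogonal_fill_in_unique[OF orthogonality[OF neF mF] ne m dm ident_hom[OF E]])
    show "(d \<cdot> m) \<cdot> (n \<cdot> e) = Ident C E \<cdot> (n \<cdot> e)"
      using comp_assoc[OF ne m d(1)] comp_assoc[OF e(2) n m] mn d(2) ident_left[OF ne] by simp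
    show "m \<cdot> (d \<cdot> m) = m \<cdot> Ident C E"
      using comp_assoc[OF m d(1) m] d(3) ident_left[OF m] ident_right[OF m] by simp
  qed
  then have "is_iso C m"
    unfolding is_iso_def using d m HomD[OF m] by auto
  then have "m \<cdot> n \<in> Final C"
    using final_comp nF iso_final HomD[OF n] HomD[OF m] by auto
  then show ?thesis using mn by simp
qed

lemma point_factorization:
  assumes "x \<in> points C X"
  shows "fin_part C x \<in> Final C" "fib_part C x \<in> DiscFib C"
    "fin_part C x \<in> Hom C (One C) (slice C x)" "fib_part C x \<in> Hom C (slice C x) X"
    "fib_part C x \<cdot> fin_part C x = x"
proof -
  have x: "x \<in> Arr C" "Dom C x = One C" "Cod C x = X"
    using assms by (auto simp: points_def Hom_def)
  show fin: "fin_part C x \<in> Final C" and fib: "fib_part C x \<in> DiscFib C"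
    using x fin_part fib_part by auto
  show "fin_part C x \<in> Hom C (One C) (slice C x)"
    using x fin final_arr dom_fin_part cod_fin_part by (auto simp: slice_def Hom_def)
  show "fib_part C x \<in> Hom C (slice C x) X"
    using x fib fib_arr cod_fib_part by (auto simp: slice_def Hom_def)
  show "fib_part C x \<cdot> fin_part C x = x"
    using x factorization by simp
qed

section \<open>Maps between slices\<close>

lemma point_map: "x \<in> points C X \<Longrightarrow> f \<in> Hom C X Y \<Longrightarrow> f \<cdot> x \<in> points C Y"
  unfolding points_def by (rule comp_hom)

text \<open>Orthogonality of \<open>fin_part C x\<close> to \<open>fib_part C y\<close>. All later
  equations between maps of slices are checked this way. The points may lie in different objects, as
  is needed for maps from \<open>X/x\<close> to a slice of \<open>Y\<close>.\<close>

lemma slice_map_unique: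
  assumes x: "x \<in> points C X" and y: "y \<in> points C Y"
    and "k \<in> Hom C (slice C x) (slice C y)" "k' \<in> Hom C (slice C x) (slice C y)"
    and "k \<cdot> fin_part C x = k' \<cdot> fin_part C x" "fib_part C y \<cdot> k = fib_part C y \<cdot> k'"
  shows "k = k'"
  by (rule orthogonal_fill_in_unique[OF orthogonality point_factorization(3)[OF x]
        point_factorization(4)[OF y] assms(3-)])
    (use point_factorization x y in blast)+

lemma slice_arrowsD:
  assumes "\<alpha> \<in> slice_arrows C x y"
  shows "\<alpha> \<in> Hom C (One C) (slice C y)" "fib_part C y \<cdot> \<alpha> = x"
  using assms by (auto simp: slice_arrows_def points_def)

text \<open>The definite description in \<open>hat\<close> is well defined: its conditions say that
  \<open>k\<close> is the fill-in of the square from \<open>fin_part C x\<close> to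
  \<open>fib_part C y\<close> with top \<open>\<alpha>\<close> and bottom
  \<open>fib_part C x\<close>.\<close>

lemma hat:
  assumes x: "x \<in> points C X" and y: "y \<in> points C X" and \<alpha>: "\<alpha> \<in> slice_arrows C x y"
  shows "hat C x y \<alpha> \<in> Hom C (slice C x) (slice C y)"
    "fib_part C y \<cdot> hat C x y \<alpha> = fib_part C x"
    "hat C x y \<alpha> \<cdot> fin_part C x = \<alpha>"
proof -
  note px = point_factorization[OF x] and py = point_factorization[OF y]
  note a = slice_arrowsD[OF \<alpha>]
  have "fib_part C y \<cdot> \<alpha> = fib_part C x \<cdot> fin_part C x" using a px by simp
  from orthogonal_fill_in[OF orthogonality[OF px(1) py(2)] px(3) py(4) a(1) px(4) this]
  have "\<exists>!k. k \<in> Hom C (slice C x) (slice C y) \<and> fib_part C y \<cdot> k = fib_part C x \<and>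
      k \<cdot> fin_part C x = \<alpha>"
    by (simp add: conj_ac)
  from theI'[OF this]
  show "hat C x y \<alpha> \<in> Hom C (slice C x) (slice C y)"
    "fib_part C y \<cdot> hat C x y \<alpha> = fib_part C x"
    "hat C x y \<alpha> \<cdot> fin_part C x = \<alpha>"
    unfolding hat_def by blast+
qed

text \<open>Orthogonality yields exactly one map satisfying the two equations. The finality that the
  definition demands in addition is automatic, because composing this map with the final map
  \<open>fin_part C x\<close> gives the final map \<open>fin_part C (f \<cdot> x)\<close>.\<close>

lemma arrow_map:
  assumes f: "f \<in> Hom C X Y" and x: "x \<in> points C X"
  shows "arrow_map C f x \<in> Hom C (slice C x) (slice C (f \<cdot> x))"
    "fib_part C (f \<cdot> x) \<cdot> arrow_map C f x = f \<cdot> fib_part C x"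
    "arrow_map C f x \<cdot> fin_part C x = fin_part C (f \<cdot> x)"
proof -
  note y = point_map[OF x f]
  note px = point_factorization[OF x] and py = point_factorization[OF y]
  have "fib_part C (f \<cdot> x) \<cdot> fin_part C (f \<cdot> x) = (f \<cdot> fib_part C x) \<cdot> fin_part C x"
    using comp_assoc[OF px(3,4) f] px(5) py(5) by simp
  from orthogonal_fill_in[OF orthogonality[OF px(1) py(2)] px(3) py(4,3) comp_hom[OF px(4) f] this]
  have ex1: "\<exists>!k. k \<in> Hom C (slice C x) (slice C (f \<cdot> x)) \<and> k \<cdot> fin_part C x = fin_part C (f \<cdot> x) \<and>
      fib_part C (f \<cdot> x) \<cdot> k = f \<cdot> fib_part C x" .
  have "\<exists>!k. k \<in> Final C \<and> k \<in> Hom C (slice C x) (slice C (f \<cdot> x)) \<and>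
      fib_part C (f \<cdot> x) \<cdot> k = f \<cdot> fib_part C x \<and> k \<cdot> fin_part C x = fin_part C (f \<cdot> x)"
    using ex1 final_cancel_right[OF px(1,3)] py(1) by metis
  from theI'[OF this]
  show "arrow_map C f x \<in> Hom C (slice C x) (slice C (f \<cdot> x))"
    "fib_part C (f \<cdot> x) \<cdot> arrow_map C f x = f \<cdot> fib_part C x"
    "arrow_map C f x \<cdot> fin_part C x = fin_part C (f \<cdot> x)"
    unfolding arrow_map_def by blast+
qed

section \<open>The underlying category of an object\<close>

lemma slice_arrows_comp:
  assumes "y \<in> points C X" "z \<in> points C X"
    and \<alpha>: "\<alpha> \<in> slice_arrows C x y" and \<beta>: "\<beta> \<in> slice_arrows C y z"
  shows "hat C y z \<beta> \<cdot> \<alpha> \<in> slice_arrows C x z"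
proof -
  note h = hat[OF assms(1,2) \<beta>] and a = slice_arrowsD[OF \<alpha>]
  have "fib_part C z \<cdot> (hat C y z \<beta> \<cdot> \<alpha>) = x"
    using comp_assoc[OF a(1) h(1) point_factorization(4)[OF assms(2)]] h(2) a(2) by simp
  then show ?thesis
    using comp_hom[OF a(1) h(1)] by (simp add: slice_arrows_def points_def)
qed

text \<open>Both sides are maps over \<open>X\<close> from the slice at \<open>x\<close> to the
  slice at \<open>z\<close> with the same value on \<open>fin_part C x\<close>. Associativity of
  composition in the underlying category rests on this.\<close>

lemma hat_comp:
  assumes x: "x \<in> points C X" and y: "y \<in> points C X" and z: "z \<in> points C X"
    and \<alpha>: "\<alpha> \<in> slice_arrows C x y" and \<beta>: "\<beta> \<in> slice_arrows C y z"
  shows "hat C x z (hat C y z \<beta> \<cdot> \<alpha>) = hat C y z \<beta> \<cdot> hat C x y \<alpha>"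
proof -
  note a = hat[OF x y \<alpha>] and b = hat[OF y z \<beta>]
  note ba = hat[OF x z slice_arrows_comp[OF y z \<alpha> \<beta>]]
  show ?thesis
  proof (rule slice_map_unique[OF x z ba(1) comp_hom[OF a(1) b(1)]])
    show "hat C x z (hat C y z \<beta> \<cdot> \<alpha>) \<cdot> fin_part C x = (hat C y z \<beta> \<cdot> hat C x y \<alpha>) \<cdot> fin_part C x"
      using ba(3) comp_assoc[OF point_factorization(3)[OF x] a(1) b(1)] a(3) by simp
    show "fib_part C z \<cdot> hat C x z (hat C y z \<beta> \<cdot> \<alpha>) = fib_part C z \<cdot> (hat C y z \<beta> \<cdot> hat C x y \<alpha>)"
      using ba(2) comp_assoc[OF a(1) b(1) point_factorization(4)[OF z]] a(2) b(2) by simp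
  qed
qed

lemma fin_part_slice_arrow: "x \<in> points C X \<Longrightarrow> fin_part C x \<in> slice_arrows C x x"
  using point_factorization by (simp add: slice_arrows_def points_def)

lemma hat_fin_part:
  assumes x: "x \<in> points C X"
  shows "hat C x x (fin_part C x) = Ident C (slice C x)"
proof -
  note px = point_factorization[OF x] and h = hat[OF x x fin_part_slice_arrow[OF x]]
  have "slice C x \<in> Obj C" using dom_obj[of "fib_part C x"] px(4) by (simp add: Hom_def)
  from ident_hom[OF this] show ?thesis
    using slice_map_unique[OF x x h(1)] h(2,3) ident_left[OF px(3)] ident_right[OF px(4)] by simp
qed

lemma Hom_underlying:
  "Hom (underlying C X) x y =
     {(x, \<alpha>, y) | \<alpha>. x \<in> points C X \<and> y \<in> points C X \<and> \<alpha> \<in> slice_arrows C x y}"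
  by (auto simp: Hom_def underlying_def)

lemma underlying_simps:
  "Obj (underlying C X) = points C X"
  "Ident (underlying C X) x = (x, fin_part C x, x)"
  "(y, \<beta>, z) \<cdot>\<^bsub>underlying C X\<^esub> (x, \<alpha>, y') = (x, hat C y z \<beta> \<cdot> \<alpha>, z)"
  by (simp_all add: underlying_def)

text \<open>The right unit law is the equation \<open>hat(3)\<close> that characterizes the
  extension of an arrow, the left one holds because the extension of \<open>fin_part C x\<close> is
  an identity, and associativity reduces to \<open>hat_comp\<close> and associativity in
  \<open>C\<close>.\<close>

lemma category_underlying: "category (underlying C X)"
proof
  fix a assume "a \<in> Arr (underlying C X)"
  then show "Dom (underlying C X) a \<in> Obj (underlying C X)"
    and "Cod (underlying C X) a \<in> Obj (underlying C X)"
    by (auto simp: underlying_def)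
next
  fix x assume "x \<in> Obj (underlying C X)"
  then show "Ident (underlying C X) x \<in> Hom (underlying C X) x x"
    using fin_part_slice_arrow by (auto simp: underlying_simps Hom_underlying)
next
  fix a b x y z assume "a \<in> Hom (underlying C X) x y" "b \<in> Hom (underlying C X) y z"
  then show "b \<cdot>\<^bsub>underlying C X\<^esub> a \<in> Hom (underlying C X) x z"
    using slice_arrows_comp by (auto simp: underlying_simps Hom_underlying)
next
  fix a x y assume a: "a \<in> Hom (underlying C X) x y"
  then show "a \<cdot>\<^bsub>underlying C X\<^esub> Ident (underlying C X) x = a"
    using hat(3) by (auto simp: underlying_simps Hom_underlying)
  show "Ident (underlying C X) y \<cdot>\<^bsub>underlying C X\<^esub> a = a"
    using a hat_fin_part ident_left slice_arrowsD(1)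
    by (fastforce simp: underlying_simps Hom_underlying)
next
  fix a b c w x y z
  assume "a \<in> Hom (underlying C X) w x" "b \<in> Hom (underlying C X) x y"
    "c \<in> Hom (underlying C X) y z"
  then obtain \<alpha> \<beta> \<gamma> where eq: "a = (w, \<alpha>, x)" "b = (x, \<beta>, y)" "c = (y, \<gamma>, z)"
    and pts: "x \<in> points C X" "y \<in> points C X" "z \<in> points C X"
    and arr: "\<alpha> \<in> slice_arrows C w x" "\<beta> \<in> slice_arrows C x y" "\<gamma> \<in> slice_arrows C y z"
    by (auto simp: Hom_underlying)
  show "c \<cdot>\<^bsub>underlying C X\<^esub> (b \<cdot>\<^bsub>underlying C X\<^esub> a) =
      (c \<cdot>\<^bsub>underlying C X\<^esub> b) \<cdot>\<^bsub>underlying C X\<^esub> a"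
    unfolding eq underlying_simps hat_comp[OF pts arr(2,3)]
    using comp_assoc[OF slice_arrowsD(1)[OF arr(1)] hat(1)[OF pts(1,2) arr(2)]
        hat(1)[OF pts(2,3) arr(3)]] by simp
qed

section \<open>The underlying functor of a map\<close>

lemma arrow_map_slice_arrow:
  assumes f: "f \<in> Hom C X Y" and y: "y \<in> points C X" and \<alpha>: "\<alpha> \<in> slice_arrows C x y"
  shows "arrow_map C f y \<cdot> \<alpha> \<in> slice_arrows C (f \<cdot> x) (f \<cdot> y)"
proof -
  note m = arrow_map[OF f y] and a = slice_arrowsD[OF \<alpha>]
  have "fib_part C (f \<cdot> y) \<cdot> (arrow_map C f y \<cdot> \<alpha>) = f \<cdot> x"
    using comp_assoc[OF a(1) m(1) point_factorization(4)[OF point_map[OF y f]]] m(2) a(2)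
      comp_assoc[OF a(1) point_factorization(4)[OF y] f] by simp
  then show ?thesis
    using comp_hom[OF a(1) m(1)] by (simp add: slice_arrows_def points_def)
qed

text \<open>Both sides go from \<open>X/x\<close> to the slice of \<open>Y\<close> at
  \<open>f \<cdot> y\<close>, restrict to \<open>arrow_map C f y \<cdot> \<alpha>\<close> along
  \<open>fin_part C x\<close>, and lie over \<open>f \<cdot> fib_part C x\<close>. Naturality is
  what makes the underlying functor preserve composition.\<close>

lemma arrow_map_natural:
  assumes f: "f \<in> Hom C X Y" and x: "x \<in> points C X" and y: "y \<in> points C X"
    and \<alpha>: "\<alpha> \<in> slice_arrows C x y"
  shows "arrow_map C f y \<cdot> hat C x y \<alpha> =
     hat C (f \<cdot> x) (f \<cdot> y) (arrow_map C f y \<cdot> \<alpha>) \<cdot> arrow_map C f x"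
proof -
  note fx = point_map[OF x f] and fy = point_map[OF y f]
  note mx = arrow_map[OF f x] and my = arrow_map[OF f y] and h = hat[OF x y \<alpha>]
  note k = hat[OF fx fy arrow_map_slice_arrow[OF f y \<alpha>]]
  note px = point_factorization[OF x] and py = point_factorization[OF y]
    and pfy = point_factorization[OF fy]
  show ?thesis
  proof (rule slice_map_unique[OF x fy comp_hom[OF h(1) my(1)] comp_hom[OF mx(1) k(1)]])
    show "(arrow_map C f y \<cdot> hat C x y \<alpha>) \<cdot> fin_part C x =
        (hat C (f \<cdot> x) (f \<cdot> y) (arrow_map C f y \<cdot> \<alpha>) \<cdot> arrow_map C f x) \<cdot> fin_part C x"
      using comp_assoc[OF px(3) h(1) my(1)] comp_assoc[OF px(3) mx(1) k(1)] h(3) mx(3) k(3) by simp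
    show "fib_part C (f \<cdot> y) \<cdot> (arrow_map C f y \<cdot> hat C x y \<alpha>) =
        fib_part C (f \<cdot> y) \<cdot> (hat C (f \<cdot> x) (f \<cdot> y) (arrow_map C f y \<cdot> \<alpha>) \<cdot> arrow_map C f x)"
      using comp_assoc[OF h(1) my(1) pfy(4)] comp_assoc[OF mx(1) k(1) pfy(4)]
        comp_assoc[OF h(1) py(4) f] h(2) mx(2) my(2) k(2) by simp
  qed
qed

lemma is_functor_underlying_map:
  assumes f: "f \<in> Hom C X Y"
  shows "is_functor (underlying C X) (underlying C Y) (underlying_map C f)"
  unfolding is_functor_def
proof (intro conjI allI ballI category_underlying)
  fix x assume x: "x \<in> Obj (underlying C X)"
  then show "obj_map (underlying_map C f) x \<in> Obj (underlying C Y)"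
    using point_map[OF _ f] by (simp add: underlying_simps underlying_map_def)
  show "arr_map (underlying_map C f) (Ident (underlying C X) x) =
      Ident (underlying C Y) (obj_map (underlying_map C f) x)"
    using x arrow_map(3)[OF f] by (simp add: underlying_simps underlying_map_def)
next
  fix x y a assume "a \<in> Hom (underlying C X) x y"
  then show "arr_map (underlying_map C f) a \<in>
      Hom (underlying C Y) (obj_map (underlying_map C f) x) (obj_map (underlying_map C f) y)"
    using arrow_map_slice_arrow[OF f] point_map[OF _ f]
    by (auto simp: Hom_underlying underlying_map_def)
next
  fix x y z a b assume "a \<in> Hom (underlying C X) x y" "b \<in> Hom (underlying C X) y z"
  then obtain \<alpha> \<beta> where eq: "a = (x, \<alpha>, y)" "b = (y, \<beta>, z)"
    and pts: "y \<in> points C X" "z \<in> points C X"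
    and arr: "\<alpha> \<in> slice_arrows C x y" "\<beta> \<in> slice_arrows C y z"
    by (auto simp: Hom_underlying)
  note a = slice_arrowsD(1)[OF arr(1)] and h = hat(1)[OF pts arr(2)]
  note my = arrow_map(1)[OF f pts(1)] and mz = arrow_map(1)[OF f pts(2)]
  note k = hat(1)[OF point_map[OF pts(1) f] point_map[OF pts(2) f]
      arrow_map_slice_arrow[OF f pts(2) arr(2)]]
  show "arr_map (underlying_map C f) (b \<cdot>\<^bsub>underlying C X\<^esub> a) =
      arr_map (underlying_map C f) b \<cdot>\<^bsub>underlying C Y\<^esub> arr_map (underlying_map C f) a"
    using comp_assoc[OF a h mz] comp_assoc[OF a my k] arrow_map_natural[OF f pts arr(2)]
    by (simp add: eq underlying_simps underlying_map_def)
qed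

section \<open>Terminal objects in the comma categories\<close>

lemma comma_arrow_underlying:
  "((x, a), h, (x', a')) \<in> Arr (comma (underlying C X) (underlying C Y) (underlying_map C f) y) \<longleftrightarrow>
   (\<exists>\<phi> \<phi>' \<eta>. a = (f \<cdot> x, \<phi>, y) \<and> a' = (f \<cdot> x', \<phi>', y) \<and> h = (x, \<eta>, x') \<and>
      x \<in> points C X \<and> x' \<in> points C X \<and> f \<cdot> x \<in> points C Y \<and> f \<cdot> x' \<in> points C Y \<and>
      y \<in> points C Y \<and> \<phi> \<in> slice_arrows C (f \<cdot> x) y \<and> \<phi>' \<in> slice_arrows C (f \<cdot> x') y \<and>
      \<eta> \<in> slice_arrows C x x' \<and> hat C (f \<cdot> x') y \<phi>' \<cdot> (arrow_map C f x' \<cdot> \<eta>) = \<phi>)"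
  by (auto simp: comma_def Hom_underlying underlying_map_def underlying_simps)

text \<open>The point \<open>p \<cdot> t\<close> factors through \<open>P\<close> and through its
  slice, each time as a final point followed by a map to which the two final points are orthogonal.
  Each factorization therefore maps to the other, and both composites are identities by uniqueness
  of fill-ins.\<close>

lemma final_point_slice_iso:
  assumes orth: "orthogonal C (fin_part C (p \<cdot> t)) p" "orthogonal C t p"
    and p: "p \<in> Hom C P X" and t: "t \<in> points C P" "t \<in> Final C"
  obtains d k where "d \<in> Hom C (slice C (p \<cdot> t)) P" "k \<in> Hom C P (slice C (p \<cdot> t))"
    "p \<cdot> d = fib_part C (p \<cdot> t)" "d \<cdot> fin_part C (p \<cdot> t) = t" "fib_part C (p \<cdot> t) \<cdot> k = p"
    "d \<cdot> k = Ident C P" "k \<cdot> d = Ident C (slice C (p \<cdot> t))"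
proof -
  let ?x = "p \<cdot> t" let ?S = "slice C ?x"
  have x: "?x \<in> points C X" by (rule point_map[OF t(1) p])
  note px = point_factorization[OF x]
  have th: "t \<in> Hom C (One C) P" using t(1) by (simp add: points_def)
  obtain d where d: "d \<in> Hom C ?S P" "d \<cdot> fin_part C ?x = t" "p \<cdot> d = fib_part C ?x"
    using orthogonal_fill_in[OF orth(1) px(3) p th px(4)] px(5) by auto
  obtain k where k: "k \<in> Hom C P ?S" "k \<cdot> t = fin_part C ?x" "fib_part C ?x \<cdot> k = p"
    using orthogonal_fill_in[OF orthogonality[OF t(2) px(2)] th px(4,3) p] px(5) by auto
  have P: "P \<in> Obj C" and S: "?S \<in> Obj C"
    using dom_obj[of p] dom_obj[of "fib_part C ?x"] p px(4) by (auto simp: Hom_def)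
  have dk: "d \<cdot> k = Ident C P"
    using orthogonal_fill_in_unique[OF orth(2) th p comp_hom[OF k(1) d(1)] ident_hom[OF P]]
      comp_assoc[OF th k(1) d(1)] comp_assoc[OF k(1) d(1) p] d k ident_left[OF th] ident_right[OF p]
    by simp
  have kd: "k \<cdot> d = Ident C ?S"
    using slice_map_unique[OF x x comp_hom[OF d(1) k(1)] ident_hom[OF S]]
      comp_assoc[OF px(3) d(1) k(1)] comp_assoc[OF d(1) k(1) px(4)] d k
      ident_left[OF px(3)] ident_right[OF px(4)]
    by simp
  show thesis by (rule that[OF d(1) k(1) d(3,2) k(3) dk kd])
qed

lemma comma_terminal:
  assumes f: "f \<in> Hom C X Y" and y: "y \<in> points C Y" and adj: "adjunctible_at C f y"
  shows "\<exists>T. is_terminal (comma (underlying C X) (underlying C Y) (underlying_map C f) y) T"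
proof -
  let ?K = "comma (underlying C X) (underlying C Y) (underlying_map C f) y"
  let ?dy = "fib_part C y"
  from adj obtain P p q t where pb: "is_pullback C f ?dy P p q"
    and t: "t \<in> points C P" "t \<in> Final C"
    unfolding adjunctible_at_def by blast
  note py = point_factorization[OF y]
  have p: "p \<in> Hom C P X" and q: "q \<in> Hom C P (slice C y)" and pq: "f \<cdot> p = ?dy \<cdot> q"
    using pullback_hom[OF pb f] by (simp_all add: slice_def)
  have th: "t \<in> Hom C (One C) P" using t(1) by (simp add: points_def)
  define x0 where "x0 = p \<cdot> t"
  have x0: "x0 \<in> points C X" unfolding x0_def by (rule point_map[OF t(1) p])
  note px = point_factorization[OF x0] and fx0 = point_map[OF x0 f]
  \<comment> \<open>Two instances are used below: the final point \<open>t\<close> and the final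
    part of \<open>x0\<close>.\<close>
  have orth: "orthogonal C e p" if "e \<in> Final C" for e
    using orthogonal_pullback[OF orthogonality[OF that py(2)] _ pb f] that final_arr by blast
  obtain d k where d: "d \<in> Hom C (slice C x0) P" and k: "k \<in> Hom C P (slice C x0)"
    and pd: "p \<cdot> d = fib_part C x0" and de: "d \<cdot> fin_part C x0 = t"
    and dk: "d \<cdot> k = Ident C P" and kd: "k \<cdot> d = Ident C (slice C x0)"
    using final_point_slice_iso[of p t P X] orth px(1) t p unfolding x0_def by metis
  \<comment> \<open>The two components \<open>x0\<close> and \<open>\<phi>0\<close> of the final
    point \<open>t\<close> form the candidate for the terminal object.\<close>
  define \<phi>0 where "\<phi>0 = q \<cdot> t"
  have \<phi>0: "\<phi>0 \<in> slice_arrows C (f \<cdot> x0) y"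
    using comp_hom[OF th q] comp_assoc[OF th q py(4)] comp_assoc[OF th p f] pq
    by (simp add: slice_arrows_def points_def \<phi>0_def x0_def)
  note h0 = hat[OF fx0 y \<phi>0] and m0 = arrow_map[OF f x0]
  \<comment> \<open>Along \<open>fin_part C x0\<close> both sides give \<open>\<phi>0\<close>, and
    over \<open>Y\<close> both become \<open>f \<cdot> fib_part C x0\<close>. The action of the
    functor followed by \<open>\<phi>0\<close> is thereby rewritten as the projection
    \<open>q\<close>.\<close>
  have qd: "hat C (f \<cdot> x0) y \<phi>0 \<cdot> arrow_map C f x0 = q \<cdot> d"
  proof (rule slice_map_unique[OF x0 y comp_hom[OF m0(1) h0(1)] comp_hom[OF d q]])
    show "(hat C (f \<cdot> x0) y \<phi>0 \<cdot> arrow_map C f x0) \<cdot> fin_part C x0 = (q \<cdot> d) \<cdot> fin_part C x0"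
      using comp_assoc[OF px(3) m0(1) h0(1)] comp_assoc[OF px(3) d q] m0(3) h0(3) de
      by (simp add: \<phi>0_def)
    show "?dy \<cdot> (hat C (f \<cdot> x0) y \<phi>0 \<cdot> arrow_map C f x0) = ?dy \<cdot> (q \<cdot> d)"
      using comp_assoc[OF m0(1) h0(1) py(4)] comp_assoc[OF d q py(4)] comp_assoc[OF d p f]
        m0(2) h0(2) pq pd by simp
  qed
  have comp_qd: "hat C (f \<cdot> x0) y \<phi>0 \<cdot> (arrow_map C f x0 \<cdot> \<eta>) = q \<cdot> (d \<cdot> \<eta>)"
    if "\<eta> \<in> Hom C (One C) (slice C x0)" for \<eta>
    using comp_assoc[OF that m0(1) h0(1)] comp_assoc[OF that d q] qd by simp
  \<comment> \<open>By \<open>comp_qd\<close> and \<open>pd\<close>, the two conditions on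
    \<open>\<eta>\<close> say that the point \<open>d \<cdot> \<eta>\<close> of \<open>P\<close> has
    components \<open>x\<close> and \<open>\<phi>\<close>. There is one such point, and
    \<open>d\<close> is invertible.\<close>
  have arrows: "\<exists>!\<eta>. \<eta> \<in> slice_arrows C x x0 \<and>
      hat C (f \<cdot> x0) y \<phi>0 \<cdot> (arrow_map C f x0 \<cdot> \<eta>) = \<phi>"
    if x: "x \<in> points C X" and \<phi>: "\<phi> \<in> slice_arrows C (f \<cdot> x) y" for x \<phi>
  proof -
    note ph = slice_arrowsD[OF \<phi>]
    \<comment> \<open>\<open>w\<close> is the point of the pullback that corresponds to the object
      of the comma category given by \<open>x\<close> and \<open>\<phi>\<close>; its preimage under
      \<open>d\<close> is \<open>k \<cdot> w\<close>.\<close>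
    obtain w where w: "w \<in> Hom C (One C) P" "p \<cdot> w = x" "q \<cdot> w = \<phi>"
      using pullback_lift[OF pb f, of x "One C" \<phi>] x ph by (auto simp: points_def slice_def)
    have kw: "k \<cdot> w \<in> Hom C (One C) (slice C x0)" by (rule comp_hom[OF w(1) k])
    have dkw: "d \<cdot> (k \<cdot> w) = w"
      using comp_assoc[OF w(1) k d] dk ident_left[OF w(1)] by simp
    have over: "fib_part C x0 \<cdot> \<eta> = p \<cdot> (d \<cdot> \<eta>)" if "\<eta> \<in> Hom C (One C) (slice C x0)" for \<eta>
      using comp_assoc[OF that d p] pd by simp
    show ?thesis
    proof (rule ex1I[of _ "k \<cdot> w"])
      show "k \<cdot> w \<in> slice_arrows C x x0 \<and>
          hat C (f \<cdot> x0) y \<phi>0 \<cdot> (arrow_map C f x0 \<cdot> (k \<cdot> w)) = \<phi>"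
        using kw over[OF kw] comp_qd[OF kw] dkw w by (simp add: slice_arrows_def points_def)
    next
      fix \<eta> assume \<eta>: "\<eta> \<in> slice_arrows C x x0 \<and>
          hat C (f \<cdot> x0) y \<phi>0 \<cdot> (arrow_map C f x0 \<cdot> \<eta>) = \<phi>"
      then have e: "\<eta> \<in> Hom C (One C) (slice C x0)" "fib_part C x0 \<cdot> \<eta> = x"
        using slice_arrowsD by blast+
      have "d \<cdot> \<eta> = w"
      proof (rule pullback_unique[OF pb f comp_hom[OF e(1) d] w(1)])
        show "p \<cdot> (d \<cdot> \<eta>) = p \<cdot> w" using over[OF e(1)] e(2) w(2) by metis
        show "q \<cdot> (d \<cdot> \<eta>) = q \<cdot> w" using comp_qd[OF e(1)] \<eta> w(3) by metis
      qed
      then show "\<eta> = k \<cdot> w"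
        using comp_assoc[OF e(1) d k] kd ident_left[OF e(1)] by simp
    qed
  qed
  let ?T = "(x0, (f \<cdot> x0, \<phi>0, y))"
  have T: "?T \<in> Obj ?K"
    using x0 fx0 y \<phi>0 by (simp add: comma_def underlying_simps underlying_map_def Hom_underlying)
  have "\<exists>!g. g \<in> Hom ?K A ?T" if A: "A \<in> Obj ?K" for A
  proof -
    obtain x \<phi> where Aeq: "A = (x, (f \<cdot> x, \<phi>, y))" and x: "x \<in> points C X"
      and \<phi>: "\<phi> \<in> slice_arrows C (f \<cdot> x) y"
      using A by (auto simp: comma_def underlying_simps underlying_map_def Hom_underlying)
    \<comment> \<open>With source and target fixed, only \<open>\<eta>\<close> is free in such a
      triple, so uniqueness of \<open>\<eta>\<close> carries over to uniqueness of the
      morphism.\<close>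
    have hom: "g \<in> Hom ?K A ?T \<longleftrightarrow> (\<exists>\<eta>. g = (A, (x, \<eta>, x0), ?T) \<and> \<eta> \<in> slice_arrows C x x0 \<and>
        hat C (f \<cdot> x0) y \<phi>0 \<cdot> (arrow_map C f x0 \<cdot> \<eta>) = \<phi>)" (is "?L \<longleftrightarrow> ?R") for g
    proof -
      obtain s h s' where g: "g = (s, h, s')" by (cases g)
      have "?L \<longleftrightarrow> s = A \<and> s' = ?T \<and> (A, h, ?T) \<in> Arr ?K"
        unfolding g by (auto simp: Hom_def comma_def)
      also have "\<dots> \<longleftrightarrow> ?R"
        unfolding g Aeq comma_arrow_underlying
        by (simp add: x x0 fx0 point_map[OF x f] y \<phi> \<phi>0) blast
      finally show ?thesis .
    qed
    show ?thesis unfolding hom using arrows[OF x \<phi>] by blast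
  qed
  then show ?thesis using T unfolding is_terminal_def by blast
qed

end

theorem corollary3p13:
  fixes C :: "('o, 'm) fact_cat" and X Y :: 'o and f :: 'm
  assumes "factorization_system C"
    and "finitely_complete C"
    and "f \<in> Hom C X Y"
    and "adjunctible C f"
  shows "adjunctible_functor (underlying C X) (underlying C Y) (underlying_map C f)"
proof -
  interpret factorization_system C by fact
  show ?thesis
    unfolding adjunctible_functor_def
    using is_functor_underlying_map[OF assms(3)] comma_terminal[OF assms(3)] assms(4)
      HomD(3)[OF assms(3)]
    by (simp add: adjunctible_def underlying_simps)
qed

end
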